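(* Let $\mathcal{C}$ be a semiabelian category, let $A$ be an object of $\mathcal{C}$, and let $(A',i')$, $(A'',i'')$ be strict subobjects of $A$. Let $A'\cap A''$ and $A'\cup A''$ denote, respectively, the infimum and the supremum of $(A',i')$ and $(A'',i'')$ in the preordered class of strict subobjects of $A$. Then there exists a bijective morphism $$A''/(A'\cap A'')\longrightarrow (A'\cup A'')/A'$$ in $\mathcal{C}$.
   Context: A morphism is called injective if it is a monomorphism, surjective if it is an epimorphism, and bijective if it is both (a bijective morphism need not be an isomorphism). A category $\mathcal{C}$ is preadditive if each $\mathrm{Mor}_{\mathcal{C}}(A,B)$ is an abelian group (with identity element $0_{AB}$), composition is $\mathbb{Z}$-bilinear, and there is an object $Z$ with $1_Z=0_{ZZ}$ (a zero object). Kernels $(\mathrm{Ker}(u),i)$ and cokernels $(\mathrm{Coker}(u),j)$ of a morphism $u$ have their usual meaning. If every morphism has a kernel and a cokernel, then for $u:A\to B$ the image $\mathrm{Im}(u)$ is the kernel of the cokernel morphism $B\to\mathrm{Coker}(u)$, with canonical morphism $\mathrm{Im}(u)\to B$, and the coimage $\mathrm{Coim}(u)$ is the cokernel of the kernel morphism $\mathrm{Ker}(u)\to A$, with canonical morphism $A\to\mathrm{Coim}(u)$; there is a unique $\overline{u}:\mathrm{Coim}(u)\to\mathrm{Im}(u)$ such that $u$ equals the composite $A\to\mathrm{Coim}(u)\xrightarrow{\overline{u}}\mathrm{Im}(u)\to B$. $\mathcal{C}$ is semiabelian (in the sense of Palamodov) if it is preadditive, every morphism has a kernel and a cokernel, finite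 products exist, and for every morphism $u$ the morphism $\overline{u}$ is bijective. A morphism $u$ is strict if $\overline{u}$ is an isomorphism. A subobject of $A$ is a pair $(A',i')$ with $i':A'\to A$ injective; it is a strict subobject if $i'$ is strict. For subobjects of $A$, $A''\le A'$ means that there is a morphism $u:A''\to A'$ with $i''=i'u$ (such $u$ is unique and injective); this is a preorder. In a semiabelian category any two strict subobjects of $A$ have an infimum and a supremum in the preordered class of strict subobjects of $A$, unique up to isomorphism of subobjects. For a strict subobject $(X,k)$ of $Y$, $Y/X$ denotes $\mathrm{Coker}(k)$. Here $A''/(A'\cap A'')$ is the cokernel of the morphism $A'\cap A''\to A''$ given by $A'\cap A''\le A''$, and $(A'\cup A'')/A'$ is the cokernel of the morphism $A'\to A'\cup A''$ given by $A'\le A'\cup A''$. *)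

theory Defs
  imports "HOL-Algebra.Group"
begin

section \<open>Categories\<close>

text \<open>Objects and morphisms live in arbitrary types; \<open>Obj\<close> and \<open>Arr\<close> single out the actual ones.
  Every morphism determines its domain and codomain. \<open>Add\<close> and \<open>Zero\<close> are the group structures on
  the morphism sets. Composition is written in the usual order, \<open>g \<cdot> f\<close> meaning \<open>f\<close> first.\<close>

record ('o, 'm) category_data =
  Obj :: "'o set"
  Arr :: "'m set"
  Dom :: "'m \<Rightarrow> 'o"
  Cod :: "'m \<Rightarrow> 'o"
  Id :: "'o \<Rightarrow> 'm"
  Comp :: "'m \<Rightarrow> 'm \<Rightarrow> 'm" (infixr \<open>\<cdot>\<index>\<close> 70)

record ('o, 'm) preadditive_data = "('o, 'm) category_data" +
  Add :: "'m \<Rightarrow> 'm \<Rightarrow> 'm"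
  Zero :: "'o \<Rightarrow> 'o \<Rightarrow> 'm"

definition Mor :: "('o, 'm, 'e) category_data_scheme \<Rightarrow> 'o \<Rightarrow> 'o \<Rightarrow> 'm set"
  where "Mor C A B = {f \<in> Arr C. Dom C f = A \<and> Cod C f = B}"

locale category =
  fixes C :: "('o, 'm, 'e) category_data_scheme" (structure)
  assumes Dom_Obj: "f \<in> Arr C \<Longrightarrow> Dom C f \<in> Obj C"
    and Cod_Obj: "f \<in> Arr C \<Longrightarrow> Cod C f \<in> Obj C"
    and Id_Mor: "A \<in> Obj C \<Longrightarrow> Id C A \<in> Mor C A A"
    and Comp_Mor: "\<lbrakk>f \<in> Mor C A B; g \<in> Mor C B D\<rbrakk> \<Longrightarrow> g \<cdot> f \<in> Mor C A D"
    and Comp_Id: "f \<in> Mor C A B \<Longrightarrow> f \<cdot> Id C A = f"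
    and Id_Comp: "f \<in> Mor C A B \<Longrightarrow> Id C B \<cdot> f = f"
    and Comp_assoc: "\<lbrakk>f \<in> Mor C A B; g \<in> Mor C B D; h \<in> Mor C D E\<rbrakk>
      \<Longrightarrow> (h \<cdot> g) \<cdot> f = h \<cdot> (g \<cdot> f)"

text \<open>Monomorphism, epimorphism, and both at once.\<close>

definition injective :: "('o, 'm, 'e) category_data_scheme \<Rightarrow> 'm \<Rightarrow> bool"
  where "injective C u \<longleftrightarrow> u \<in> Arr C \<and>
    (\<forall>X. \<forall>f \<in> Mor C X (Dom C u). \<forall>g \<in> Mor C X (Dom C u).
      u \<cdot>\<^bsub>C\<^esub> f = u \<cdot>\<^bsub>C\<^esub> g \<longrightarrow> f = g)"

definition surjective :: "('o, 'm, 'e) category_data_scheme \<Rightarrow> 'm \<Rightarrow> bool"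
  where "surjective C u \<longleftrightarrow> u \<in> Arr C \<and>
    (\<forall>X. \<forall>f \<in> Mor C (Cod C u) X. \<forall>g \<in> Mor C (Cod C u) X.
      f \<cdot>\<^bsub>C\<^esub> u = g \<cdot>\<^bsub>C\<^esub> u \<longrightarrow> f = g)"

definition bijective :: "('o, 'm, 'e) category_data_scheme \<Rightarrow> 'm \<Rightarrow> bool"
  where "bijective C u \<longleftrightarrow> injective C u \<and> surjective C u"

definition isomorphism :: "('o, 'm, 'e) category_data_scheme \<Rightarrow> 'm \<Rightarrow> bool"
  where "isomorphism C u \<longleftrightarrow> u \<in> Arr C \<and>
    (\<exists>v \<in> Mor C (Cod C u) (Dom C u). v \<cdot>\<^bsub>C\<^esub> u = Id C (Dom C u) \<and> u \<cdot>\<^bsub>C\<^esub> v = Id C (Cod C u))"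

text \<open>A product of the family \<open>X 0, \<dots>, X (n - 1)\<close>; for \<open>n = 0\<close> this is a terminal object.\<close>

definition is_product ::
    "('o, 'm, 'e) category_data_scheme \<Rightarrow> nat \<Rightarrow> (nat \<Rightarrow> 'o) \<Rightarrow> 'o \<Rightarrow> (nat \<Rightarrow> 'm) \<Rightarrow> bool"
  where "is_product C n X P p \<longleftrightarrow> P \<in> Obj C \<and> (\<forall>k<n. p k \<in> Mor C P (X k)) \<and>
    (\<forall>T \<in> Obj C. \<forall>f. (\<forall>k<n. f k \<in> Mor C T (X k)) \<longrightarrow>
      (\<exists>!h. h \<in> Mor C T P \<and> (\<forall>k<n. p k \<cdot>\<^bsub>C\<^esub> h = f k)))"


section \<open>Preadditive categories\<close>

definition Mor_group :: "('o, 'm, 'e) preadditive_data_scheme \<Rightarrow> 'o \<Rightarrow> 'o \<Rightarrow> 'm monoid"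
  where "Mor_group C A B = \<lparr>carrier = Mor C A B, mult = Add C, one = Zero C A B\<rparr>"

locale preadditive_category = category C
  for C :: "('o, 'm, 'e) preadditive_data_scheme" (structure) +
  assumes Mor_comm_group: "\<lbrakk>A \<in> Obj C; B \<in> Obj C\<rbrakk> \<Longrightarrow> comm_group (Mor_group C A B)"
    and Comp_Add: "\<lbrakk>f \<in> Mor C A B; g \<in> Mor C A B; h \<in> Mor C B D\<rbrakk>
      \<Longrightarrow> h \<cdot> Add C f g = Add C (h \<cdot> f) (h \<cdot> g)"
    and Add_Comp: "\<lbrakk>h \<in> Mor C A B; f \<in> Mor C B D; g \<in> Mor C B D\<rbrakk>
      \<Longrightarrow> Add C f g \<cdot> h = Add C (f \<cdot> h) (g \<cdot> h)"
    and zero_object: "\<exists>Z \<in> Obj C. Id C Z = Zero C Z Z"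

text \<open>Kernels, cokernels, images and coimages are treated as relations, so that no particular
  choice is made.\<close>

definition is_kernel :: "('o, 'm, 'e) preadditive_data_scheme \<Rightarrow> 'm \<Rightarrow> 'o \<Rightarrow> 'm \<Rightarrow> bool"
  where "is_kernel C u K i \<longleftrightarrow> u \<in> Arr C \<and> i \<in> Mor C K (Dom C u) \<and>
    u \<cdot>\<^bsub>C\<^esub> i = Zero C K (Cod C u) \<and>
    (\<forall>X. \<forall>f \<in> Mor C X (Dom C u). u \<cdot>\<^bsub>C\<^esub> f = Zero C X (Cod C u) \<longrightarrow>
      (\<exists>!g. g \<in> Mor C X K \<and> i \<cdot>\<^bsub>C\<^esub> g = f))"

definition is_cokernel :: "('o, 'm, 'e) preadditive_data_scheme \<Rightarrow> 'm \<Rightarrow> 'o \<Rightarrow> 'm \<Rightarrow> bool"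
  where "is_cokernel C u Q j \<longleftrightarrow> u \<in> Arr C \<and> j \<in> Mor C (Cod C u) Q \<and>
    j \<cdot>\<^bsub>C\<^esub> u = Zero C (Dom C u) Q \<and>
    (\<forall>X. \<forall>f \<in> Mor C (Cod C u) X. f \<cdot>\<^bsub>C\<^esub> u = Zero C (Dom C u) X \<longrightarrow>
      (\<exists>!g. g \<in> Mor C Q X \<and> g \<cdot>\<^bsub>C\<^esub> j = f))"

definition is_image :: "('o, 'm, 'e) preadditive_data_scheme \<Rightarrow> 'm \<Rightarrow> 'o \<Rightarrow> 'm \<Rightarrow> bool"
  where "is_image C u I m \<longleftrightarrow> (\<exists>Q j. is_cokernel C u Q j \<and> is_kernel C j I m)"

definition is_coimage :: "('o, 'm, 'e) preadditive_data_scheme \<Rightarrow> 'm \<Rightarrow> 'o \<Rightarrow> 'm \<Rightarrow> bool"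
  where "is_coimage C u D e \<longleftrightarrow> (\<exists>K i. is_kernel C u K i \<and> is_cokernel C i D e)"

text \<open>\<open>w\<close> is the morphism from \<open>Coim u\<close> to \<open>Im u\<close> induced by \<open>u\<close>, for some choice of image and
  coimage. Once these are chosen it exists and is unique (\<open>induced_ex1\<close> below).\<close>

definition is_induced :: "('o, 'm, 'e) preadditive_data_scheme \<Rightarrow> 'm \<Rightarrow> 'm \<Rightarrow> bool"
  where "is_induced C u w \<longleftrightarrow>
    (\<exists>D e I m. is_coimage C u D e \<and> is_image C u I m \<and> w \<in> Mor C D I \<and>
      u = m \<cdot>\<^bsub>C\<^esub> w \<cdot>\<^bsub>C\<^esub> e)"

text \<open>Whether the induced morphism is an isomorphism does not depend on the choice of image and
  coimage (\<open>strict_induced_isomorphism\<close> below).\<close>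

definition strict :: "('o, 'm, 'e) preadditive_data_scheme \<Rightarrow> 'm \<Rightarrow> bool"
  where "strict C u \<longleftrightarrow> (\<exists>w. is_induced C u w \<and> isomorphism C w)"


section \<open>Semiabelian categories\<close>

locale semiabelian_category = preadditive_category +
  assumes kernel_exists: "u \<in> Arr C \<Longrightarrow> \<exists>K i. is_kernel C u K i"
    and cokernel_exists: "u \<in> Arr C \<Longrightarrow> \<exists>Q j. is_cokernel C u Q j"
    and product_exists: "(\<And>k. k < n \<Longrightarrow> X k \<in> Obj C) \<Longrightarrow> \<exists>P p. is_product C n X P p"
    and induced_bijective: "\<lbrakk>u \<in> Arr C; is_induced C u w\<rbrakk> \<Longrightarrow> bijective C w"

text \<open>The preordered class of strict subobjects \<open>(S, i)\<close> of \<open>A\<close>, as an order structure whose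
  equivalence is isomorphism of subobjects; infima and suprema are then \<^const>\<open>greatest\<close> lower and
  \<^const>\<open>least\<close> upper bounds in it.\<close>

definition subobject_le ::
    "('o, 'm, 'e) category_data_scheme \<Rightarrow> 'o \<times> 'm \<Rightarrow> 'o \<times> 'm \<Rightarrow> bool"
  where "subobject_le C S T \<longleftrightarrow> (\<exists>u \<in> Mor C (fst S) (fst T). snd S = snd T \<cdot>\<^bsub>C\<^esub> u)"

definition strict_subobjects ::
    "('o, 'm, 'e) preadditive_data_scheme \<Rightarrow> 'o \<Rightarrow> ('o \<times> 'm) gorder"
  where "strict_subobjects C A =
    \<lparr>carrier = {(S, i). i \<in> Mor C S A \<and> injective C i \<and> strict C i},
     eq = (\<lambda>S T. subobject_le C S T \<and> subobject_le C T S),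
     le = subobject_le C\<rparr>"


section \<open>The induced morphism is well defined\<close>

lemma MorD: "f \<in> Mor C A B \<Longrightarrow> f \<in> Arr C \<and> Dom C f = A \<and> Cod C f = B"
  by (simp add: Mor_def)

context category
begin

lemma Mor_Obj: "f \<in> Mor C A B \<Longrightarrow> A \<in> Obj C \<and> B \<in> Obj C"
  using Dom_Obj Cod_Obj by (auto simp: Mor_def)

end

context preadditive_category
begin

lemma Zero_Mor: "\<lbrakk>A \<in> Obj C; B \<in> Obj C\<rbrakk> \<Longrightarrow> Zero C A B \<in> Mor C A B"
proof -
  assume "A \<in> Obj C" "B \<in> Obj C"
  then interpret G: comm_group "Mor_group C A B"
    by (rule Mor_comm_group)
  show ?thesis
    using G.one_closed by (simp add: Mor_group_def)
qed

lemma Add_idem: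
  assumes "z \<in> Mor C A B" and "Add C z z = z"
  shows "z = Zero C A B"
proof -
  interpret G: comm_group "Mor_group C A B"
    using Mor_comm_group Mor_Obj[OF assms(1)] by blast
  show ?thesis
    using G.l_cancel_one[of z z] assms by (simp add: Mor_group_def)
qed

lemma Add_Zero: "\<lbrakk>A \<in> Obj C; B \<in> Obj C\<rbrakk> \<Longrightarrow> Add C (Zero C A B) (Zero C A B) = Zero C A B"
proof -
  assume "A \<in> Obj C" "B \<in> Obj C"
  then interpret G: comm_group "Mor_group C A B"
    by (rule Mor_comm_group)
  show ?thesis
    using G.l_one[OF G.one_closed] by (simp add: Mor_group_def)
qed

lemma Comp_Zero:
  assumes "A \<in> Obj C" "h \<in> Mor C B D"
  shows "h \<cdot> Zero C A B = Zero C A D"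
proof -
  have B: "B \<in> Obj C" using Mor_Obj[OF assms(2)] by blast
  note z = Zero_Mor[OF assms(1) B]
  show ?thesis
    using Add_idem[OF Comp_Mor[OF z assms(2)]] Comp_Add[OF z z assms(2)] Add_Zero[OF assms(1) B]
    by simp
qed

lemma Zero_Comp:
  assumes "D \<in> Obj C" "h \<in> Mor C A B"
  shows "Zero C B D \<cdot> h = Zero C A D"
proof -
  have B: "B \<in> Obj C" using Mor_Obj[OF assms(2)] by blast
  note z = Zero_Mor[OF B assms(1)]
  show ?thesis
    using Add_idem[OF Comp_Mor[OF assms(2) z]] Add_Comp[OF assms(2) z z] Add_Zero[OF B assms(1)]
    by simp
qed

lemma kernel_unique_factor:
  assumes "is_kernel C u K i" "f \<in> Mor C X K" "g \<in> Mor C X K" "i \<cdot> f = i \<cdot> g"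
  shows "f = g"
proof -
  have u: "u \<in> Mor C (Dom C u) (Cod C u)" and i: "i \<in> Mor C K (Dom C u)"
    and z: "u \<cdot> i = Zero C K (Cod C u)"
    using assms(1) by (auto simp: is_kernel_def Mor_def)
  have "u \<cdot> (i \<cdot> g) = Zero C X (Cod C u)"
    using Comp_assoc[OF assms(3) i u] z Zero_Comp[OF _ assms(3)] Mor_Obj[OF u] by simp
  moreover have "i \<cdot> g \<in> Mor C X (Dom C u)"
    using Comp_Mor assms(3) i by blast
  ultimately have "\<exists>!h. h \<in> Mor C X K \<and> i \<cdot> h = i \<cdot> g"
    using assms(1) by (auto simp: is_kernel_def)
  then show ?thesis
    using assms by auto
qed

lemma cokernel_unique_factor:
  assumes "is_cokernel C u Q j" "f \<in> Mor C Q X" "g \<in> Mor C Q X" "f \<cdot> j = g \<cdot> j"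
  shows "f = g"
proof -
  have u: "u \<in> Mor C (Dom C u) (Cod C u)" and j: "j \<in> Mor C (Cod C u) Q"
    and z: "j \<cdot> u = Zero C (Dom C u) Q"
    using assms(1) by (auto simp: is_cokernel_def Mor_def)
  have "(g \<cdot> j) \<cdot> u = Zero C (Dom C u) X"
    using Comp_assoc[OF u j assms(3)] z Comp_Zero[OF _ assms(3)] Mor_Obj[OF u] by simp
  moreover have "g \<cdot> j \<in> Mor C (Cod C u) X"
    using Comp_Mor assms(3) j by blast
  ultimately have "\<exists>!h. h \<in> Mor C Q X \<and> h \<cdot> j = g \<cdot> j"
    using assms(1) by (auto simp: is_cokernel_def)
  then show ?thesis
    using assms by auto
qed

lemma kernel_factor:
  assumes "is_kernel C u K i" "u \<in> Mor C A B" "f \<in> Mor C X A" "u \<cdot> f = Zero C X B"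
  obtains g where "g \<in> Mor C X K" "i \<cdot> g = f"
  using assms MorD[OF assms(2)] unfolding is_kernel_def by metis

lemma cokernel_factor:
  assumes "is_cokernel C u Q j" "u \<in> Mor C A B" "f \<in> Mor C B X" "f \<cdot> u = Zero C A X"
  obtains g where "g \<in> Mor C Q X" "g \<cdot> j = f"
  using assms MorD[OF assms(2)] unfolding is_cokernel_def by metis

lemma induced_ex1:
  assumes "is_coimage C u D e" "is_image C u I m"
  shows "\<exists>!w. w \<in> Mor C D I \<and> u = m \<cdot> w \<cdot> e"
proof -
  obtain K i where k: "is_kernel C u K i" and e: "is_cokernel C i D e"
    using assms(1) by (auto simp: is_coimage_def)
  obtain Q j where c: "is_cokernel C u Q j" and m: "is_kernel C j I m"
    using assms(2) by (auto simp: is_image_def)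
  define A B where "A = Dom C u" and "B = Cod C u"
  have uM: "u \<in> Mor C A B" and iM: "i \<in> Mor C K A"
    using k by (auto simp: is_kernel_def Mor_def A_def B_def)
  have eM: "e \<in> Mor C A D"
    using e MorD[OF iM] by (auto simp: is_cokernel_def)
  have jM: "j \<in> Mor C B Q"
    using c by (auto simp: is_cokernel_def B_def)
  have mM: "m \<in> Mor C I B"
    using m MorD[OF jM] by (auto simp: is_kernel_def)
  have "u \<cdot> i = Zero C K B" "j \<cdot> u = Zero C A Q"
    using k c by (simp_all add: is_kernel_def is_cokernel_def A_def B_def)
  then obtain t where t: "t \<in> Mor C D B" "t \<cdot> e = u"
    using cokernel_factor[OF e iM uM] by blast
  have "(j \<cdot> t) \<cdot> e = Zero C D Q \<cdot> e"
    using \<open>j \<cdot> u = _\<close> t Comp_assoc[OF eM t(1) jM] Zero_Comp[OF _ eM] Mor_Obj[OF jM] by auto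
  then have "j \<cdot> t = Zero C D Q"
    using cokernel_unique_factor[OF e] Comp_Mor[OF t(1) jM] Zero_Mor Mor_Obj[OF eM] Mor_Obj[OF jM]
    by blast
  then obtain w where w: "w \<in> Mor C D I" "m \<cdot> w = t"
    using kernel_factor[OF m jM t(1)] by blast
  show ?thesis
  proof (rule ex1I[of _ w])
    show "w \<in> Mor C D I \<and> u = m \<cdot> w \<cdot> e"
      using w t Comp_assoc[OF eM w(1) mM] by auto
  next
    fix w' assume w': "w' \<in> Mor C D I \<and> u = m \<cdot> w' \<cdot> e"
    then have "(m \<cdot> w') \<cdot> e = (m \<cdot> w) \<cdot> e"
      using w t Comp_assoc[OF eM _ mM] by auto
    then have "m \<cdot> w' = m \<cdot> w"
      using cokernel_unique_factor[OF e] Comp_Mor[OF _ mM] w w' by blast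
    then show "w' = w"
      using kernel_unique_factor[OF m] w w' by blast
  qed
qed

lemma coimage_factor:
  assumes "is_coimage C u D e" "is_coimage C u D' e'"
  obtains a where "a \<in> Mor C D D'" "a \<cdot> e = e'" "e \<in> Mor C (Dom C u) D"
    "\<And>X f g. \<lbrakk>f \<in> Mor C D X; g \<in> Mor C D X; f \<cdot> e = g \<cdot> e\<rbrakk> \<Longrightarrow> f = g"
proof -
  obtain K i where k: "is_kernel C u K i" and e: "is_cokernel C i D e"
    using assms(1) by (auto simp: is_coimage_def)
  obtain K' i' where k': "is_kernel C u K' i'" and e': "is_cokernel C i' D' e'"
    using assms(2) by (auto simp: is_coimage_def)
  have iM: "i \<in> Mor C K (Dom C u)" and ui: "u \<cdot> i = Zero C K (Cod C u)"
    and uM: "u \<in> Mor C (Dom C u) (Cod C u)"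
    using k by (auto simp: is_kernel_def Mor_def)
  obtain x where x: "x \<in> Mor C K K'" "i' \<cdot> x = i"
    using kernel_factor[OF k' uM iM ui] by blast
  have i'M: "i' \<in> Mor C K' (Dom C u)"
    using k' by (auto simp: is_kernel_def)
  have e'M: "e' \<in> Mor C (Dom C u) D'" and "e' \<cdot> i' = Zero C K' D'"
    using e' MorD[OF i'M] by (auto simp: is_cokernel_def)
  then have "e' \<cdot> i = Zero C K D'"
    using x Comp_assoc[OF x(1) i'M e'M] Zero_Comp[OF _ x(1)] Mor_Obj[OF e'M] by simp
  then obtain a where "a \<in> Mor C D D'" "a \<cdot> e = e'"
    using cokernel_factor[OF e iM e'M] by blast
  moreover have "e \<in> Mor C (Dom C u) D"
    using e MorD[OF iM] by (auto simp: is_cokernel_def)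
  ultimately show thesis
    using that cokernel_unique_factor[OF e] by blast
qed

lemma image_factor:
  assumes "is_image C u I m" "is_image C u I' m'"
  obtains b where "b \<in> Mor C I I'" "m' \<cdot> b = m" "m \<in> Mor C I (Cod C u)"
    "\<And>X f g. \<lbrakk>f \<in> Mor C X I; g \<in> Mor C X I; m \<cdot> f = m \<cdot> g\<rbrakk> \<Longrightarrow> f = g"
proof -
  obtain Q j where c: "is_cokernel C u Q j" and m: "is_kernel C j I m"
    using assms(1) by (auto simp: is_image_def)
  obtain Q' j' where c': "is_cokernel C u Q' j'" and m': "is_kernel C j' I' m'"
    using assms(2) by (auto simp: is_image_def)
  have j'M: "j' \<in> Mor C (Cod C u) Q'" and ju: "j' \<cdot> u = Zero C (Dom C u) Q'"
    and uM: "u \<in> Mor C (Dom C u) (Cod C u)"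
    using c' by (auto simp: is_cokernel_def Mor_def)
  obtain x where x: "x \<in> Mor C Q Q'" "x \<cdot> j = j'"
    using cokernel_factor[OF c uM j'M ju] by blast
  have jM: "j \<in> Mor C (Cod C u) Q"
    using c by (auto simp: is_cokernel_def)
  have mM: "m \<in> Mor C I (Cod C u)" and "j \<cdot> m = Zero C I Q"
    using m MorD[OF jM] by (auto simp: is_kernel_def)
  then have "j' \<cdot> m = Zero C I Q'"
    using x Comp_assoc[OF mM jM x(1)] Comp_Zero[OF _ x(1)] Mor_Obj[OF mM] by simp
  then obtain b where "b \<in> Mor C I I'" "m' \<cdot> b = m"
    using kernel_factor[OF m' j'M mM] by blast
  then show thesis
    using that kernel_unique_factor[OF m] mM by blast
qed

lemma strict_induced_isomorphism:
  assumes "strict C u" "is_induced C u w"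
  shows "isomorphism C w"
proof -
  obtain w0 where w0: "is_induced C u w0" "isomorphism C w0"
    using assms(1) by (auto simp: strict_def)
  obtain D e I m where c: "is_coimage C u D e" and i: "is_image C u I m"
    and wM: "w \<in> Mor C D I" and uw: "u = m \<cdot> w \<cdot> e"
    using assms(2) by (auto simp: is_induced_def)
  obtain D0 e0 I0 m0 where c0: "is_coimage C u D0 e0" and i0: "is_image C u I0 m0"
    and w0M: "w0 \<in> Mor C D0 I0" and uw0: "u = m0 \<cdot> w0 \<cdot> e0"
    using w0(1) by (auto simp: is_induced_def)
  obtain v0 where v0: "v0 \<in> Mor C I0 D0" "v0 \<cdot> w0 = Id C D0" "w0 \<cdot> v0 = Id C I0"
    using w0(2) MorD[OF w0M] unfolding isomorphism_def by metis
  obtain a where a: "a \<in> Mor C D D0" "a \<cdot> e = e0" and eM: "e \<in> Mor C (Dom C u) D"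
    and e_epi: "\<And>X f g. \<lbrakk>f \<in> Mor C D X; g \<in> Mor C D X; f \<cdot> e = g \<cdot> e\<rbrakk> \<Longrightarrow> f = g"
    using coimage_factor[OF c c0] by blast
  obtain a' where a': "a' \<in> Mor C D0 D" "a' \<cdot> e0 = e" and e0M: "e0 \<in> Mor C (Dom C u) D0"
    and e0_epi: "\<And>X f g. \<lbrakk>f \<in> Mor C D0 X; g \<in> Mor C D0 X; f \<cdot> e0 = g \<cdot> e0\<rbrakk> \<Longrightarrow> f = g"
    using coimage_factor[OF c0 c] by blast
  obtain b where b: "b \<in> Mor C I I0" "m0 \<cdot> b = m" and mM: "m \<in> Mor C I (Cod C u)"
    and m_mono: "\<And>X f g. \<lbrakk>f \<in> Mor C X I; g \<in> Mor C X I; m \<cdot> f = m \<cdot> g\<rbrakk> \<Longrightarrow> f = g"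
    using image_factor[OF i i0] by blast
  obtain b' where b': "b' \<in> Mor C I0 I" "m \<cdot> b' = m0" and m0M: "m0 \<in> Mor C I0 (Cod C u)"
    and m0_mono: "\<And>X f g. \<lbrakk>f \<in> Mor C X I0; g \<in> Mor C X I0; m0 \<cdot> f = m0 \<cdot> g\<rbrakk> \<Longrightarrow> f = g"
    using image_factor[OF i0 i] by blast
  have obj: "D \<in> Obj C" "I \<in> Obj C" "D0 \<in> Obj C" "I0 \<in> Obj C"
    using Mor_Obj wM w0M by auto
  have aa: "a' \<cdot> a = Id C D"
    using e_epi[OF Comp_Mor[OF a(1) a'(1)] Id_Mor[OF obj(1)]] Comp_assoc[OF eM a(1) a'(1)]
      a(2) a'(2) Id_Comp[OF eM] by simp
  have aa0: "a \<cdot> a' = Id C D0"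
    using e0_epi[OF Comp_Mor[OF a'(1) a(1)] Id_Mor[OF obj(3)]] Comp_assoc[OF e0M a'(1) a(1)]
      a(2) a'(2) Id_Comp[OF e0M] by simp
  have bb: "b' \<cdot> b = Id C I"
    using m_mono[OF Comp_Mor[OF b(1) b'(1)] Id_Mor[OF obj(2)]] Comp_assoc[OF b(1) b'(1) mM]
      b(2) b'(2) Comp_Id[OF mM] by simp
  have bb0: "b \<cdot> b' = Id C I0"
    using m0_mono[OF Comp_Mor[OF b'(1) b(1)] Id_Mor[OF obj(4)]] Comp_assoc[OF b'(1) b(1) m0M]
      b(2) b'(2) Comp_Id[OF m0M] by simp
  have wa: "w0 \<cdot> a \<in> Mor C D I0" and va: "v0 \<cdot> b \<in> Mor C I D0"
    using Comp_Mor a b v0 w0M by blast+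
  have "m \<cdot> (b' \<cdot> w0 \<cdot> a) \<cdot> e = (m \<cdot> b') \<cdot> w0 \<cdot> (a \<cdot> e)"
    using Comp_assoc[OF eM wa b'(1)] Comp_assoc[OF eM a(1) w0M]
      Comp_assoc[OF Comp_Mor[OF eM wa] b'(1) mM] by simp
  then have "u = m \<cdot> (b' \<cdot> w0 \<cdot> a) \<cdot> e"
    using a(2) b'(2) uw0 by simp
  then have w: "w = b' \<cdot> w0 \<cdot> a"
    using induced_ex1[OF c i] wM uw Comp_Mor[OF wa b'(1)] by blast
  define v where "v = a' \<cdot> v0 \<cdot> b"
  have vM: "v \<in> Mor C I D"
    using Comp_Mor[OF va a'(1)] by (simp add: v_def)
  have "v \<cdot> w = a' \<cdot> v0 \<cdot> (b \<cdot> b') \<cdot> w0 \<cdot> a"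
    unfolding v_def w
    using Comp_assoc[OF Comp_Mor[OF wa b'(1)] va a'(1)] Comp_assoc[OF Comp_Mor[OF wa b'(1)] b(1) v0(1)]
      Comp_assoc[OF wa b'(1) b(1)] by simp
  also have "\<dots> = a' \<cdot> (v0 \<cdot> w0) \<cdot> a"
    using bb0 Id_Comp[OF wa] Comp_assoc[OF a(1) w0M v0(1)] by simp
  also have "\<dots> = Id C D"
    using v0(2) Id_Comp[OF a(1)] aa by simp
  finally have vw: "v \<cdot> w = Id C D" .
  have "w \<cdot> v = b' \<cdot> w0 \<cdot> (a \<cdot> a') \<cdot> v0 \<cdot> b"
    unfolding v_def w
    using Comp_assoc[OF Comp_Mor[OF va a'(1)] wa b'(1)] Comp_assoc[OF Comp_Mor[OF va a'(1)] a(1) w0M]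
      Comp_assoc[OF va a'(1) a(1)] by simp
  also have "\<dots> = b' \<cdot> (w0 \<cdot> v0) \<cdot> b"
    using aa0 Id_Comp[OF va] Comp_assoc[OF b(1) v0(1) w0M] by simp
  also have "\<dots> = Id C I"
    using v0(3) Id_Comp[OF b(1)] bb by simp
  finally have wv: "w \<cdot> v = Id C I" .
  show ?thesis
    using vM vw wv MorD[OF wM] by (auto simp: isomorphism_def)
qed

end

end

theory Submission
  imports Defs
begin

text \<open>Write \<open>p' : A \<rightarrow> A/A'\<close> for the cokernel of \<open>i'\<close>. As in an abelian category, both quotients are
  compared inside \<open>A/A'\<close>: the restriction of \<open>p'\<close> to \<open>A''\<close> has kernel \<open>A' \<inter> A''\<close> and its restriction to
  \<open>A' \<union> A''\<close> has kernel \<open>A'\<close>, so that \<open>A''/(A' \<inter> A'')\<close> and \<open>(A' \<union> A'')/A'\<close> are the coimages of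
  these two restrictions. Since the induced morphism from a coimage to an image is injective, both
  quotients are embedded in \<open>A/A'\<close>, and the inclusion of \<open>A''\<close> in \<open>A' \<union> A''\<close> induces a morphism \<open>b\<close>
  between them that commutes with the embeddings. Therefore \<open>b\<close> is injective.

  For surjectivity, let \<open>f b = g b\<close>. The composites of \<open>f\<close> and \<open>g\<close> with \<open>A' \<union> A'' \<rightarrow> (A' \<union> A'')/A'\<close>
  agree on \<open>A''\<close>, and on \<open>A'\<close>, where both vanish. What is left to prove is that \<open>A'\<close> and \<open>A''\<close>
  together are epimorphic onto their supremum (\<open>supremum_jointly_epi\<close>).

  The infimum and the supremum are given only by their order properties among \<^emph>\<open>strict\<close> subobjects,
  while these arguments involve arbitrary morphisms into \<open>A\<close>. The bridge is \<open>image_factorization\<close>: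
  every morphism into \<open>A\<close> is a surjective morphism followed by the inclusion of a strict subobject,
  its image, which is the least strict subobject through which it factors.\<close>

section \<open>Injective, surjective and strict morphisms\<close>

context category
begin

lemma injective_iff:
  assumes "u \<in> Mor C A B"
  shows "injective C u \<longleftrightarrow>
    (\<forall>X. \<forall>f \<in> Mor C X A. \<forall>g \<in> Mor C X A. u \<cdot> f = u \<cdot> g \<longrightarrow> f = g)"
  using MorD[OF assms] by (simp add: injective_def)

lemma surjective_iff:
  assumes "u \<in> Mor C A B"
  shows "surjective C u \<longleftrightarrow>
    (\<forall>X. \<forall>f \<in> Mor C B X. \<forall>g \<in> Mor C B X. f \<cdot> u = g \<cdot> u \<longrightarrow> f = g)"
  using MorD[OF assms] by (simp add: surjective_def)

lemma injectiveD:
  assumes "injective C u" "u \<in> Mor C A B" "f \<in> Mor C X A" "g \<in> Mor C X A" "u \<cdot> f = u \<cdot> g"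
  shows "f = g"
  using assms injective_iff[OF assms(2)] by blast

lemma surjectiveD:
  assumes "surjective C u" "u \<in> Mor C A B" "f \<in> Mor C B X" "g \<in> Mor C B X" "f \<cdot> u = g \<cdot> u"
  shows "f = g"
  using assms surjective_iff[OF assms(2)] by blast

lemma injective_Comp:
  assumes "u \<in> Mor C A B" "v \<in> Mor C B D" "injective C u" "injective C v"
  shows "injective C (v \<cdot> u)"
proof -
  have "f = g" if "f \<in> Mor C X A" "g \<in> Mor C X A" "(v \<cdot> u) \<cdot> f = (v \<cdot> u) \<cdot> g" for X f g
  proof -
    have "v \<cdot> u \<cdot> f = v \<cdot> u \<cdot> g"
      using that(3) Comp_assoc[OF that(1) assms(1,2)] Comp_assoc[OF that(2) assms(1,2)] by simp
    then have "u \<cdot> f = u \<cdot> g"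
      using injectiveD[OF assms(4,2) Comp_Mor[OF that(1) assms(1)] Comp_Mor[OF that(2) assms(1)]]
      by blast
    then show ?thesis
      using injectiveD[OF assms(3,1) that(1,2)] by blast
  qed
  then show ?thesis
    using injective_iff[OF Comp_Mor[OF assms(1,2)]] by blast
qed

lemma surjective_Comp:
  assumes "u \<in> Mor C A B" "v \<in> Mor C B D" "surjective C u" "surjective C v"
  shows "surjective C (v \<cdot> u)"
proof -
  have "f = g" if "f \<in> Mor C D X" "g \<in> Mor C D X" "f \<cdot> v \<cdot> u = g \<cdot> v \<cdot> u" for X f g
  proof -
    have "(f \<cdot> v) \<cdot> u = (g \<cdot> v) \<cdot> u"
      using that(3) Comp_assoc[OF assms(1,2) that(1)] Comp_assoc[OF assms(1,2) that(2)] by simp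
    then have "f \<cdot> v = g \<cdot> v"
      using surjectiveD[OF assms(3,1) Comp_Mor[OF assms(2) that(1)] Comp_Mor[OF assms(2) that(2)]]
      by blast
    then show ?thesis
      using surjectiveD[OF assms(4,2) that(1,2)] by blast
  qed
  then show ?thesis
    using surjective_iff[OF Comp_Mor[OF assms(1,2)]] by blast
qed

lemma injective_right_factor:
  assumes "u \<in> Mor C A B" "v \<in> Mor C B D" "injective C (v \<cdot> u)"
  shows "injective C u"
proof -
  have "f = g" if "f \<in> Mor C X A" "g \<in> Mor C X A" "u \<cdot> f = u \<cdot> g" for X f g
    using that(3) Comp_assoc[OF that(1) assms(1,2)] Comp_assoc[OF that(2) assms(1,2)]
      injectiveD[OF assms(3) Comp_Mor[OF assms(1,2)] that(1,2)] by simp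
  then show ?thesis
    using injective_iff[OF assms(1)] by blast
qed

end

context preadditive_category
begin

lemma is_kernelI:
  assumes "u \<in> Mor C A B" "i \<in> Mor C K A" "u \<cdot> i = Zero C K B" "injective C i"
    and "\<And>X f. \<lbrakk>f \<in> Mor C X A; u \<cdot> f = Zero C X B\<rbrakk> \<Longrightarrow> \<exists>g \<in> Mor C X K. i \<cdot> g = f"
  shows "is_kernel C u K i"
proof -
  have "\<exists>!g. g \<in> Mor C X K \<and> i \<cdot> g = f" if "f \<in> Mor C X A" "u \<cdot> f = Zero C X B" for X f
    using assms(5)[OF that] injectiveD[OF assms(4,2)] by metis
  then show ?thesis
    using assms(2,3) MorD[OF assms(1)] unfolding is_kernel_def by auto
qed

lemma is_kernelD:
  assumes "is_kernel C u K i" "u \<in> Mor C A B"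
  shows "i \<in> Mor C K A" "u \<cdot> i = Zero C K B" "injective C i"
proof -
  show i: "i \<in> Mor C K A" and "u \<cdot> i = Zero C K B"
    using assms(1) MorD[OF assms(2)] by (auto simp: is_kernel_def)
  show "injective C i"
    using injective_iff[OF i] kernel_unique_factor[OF assms(1)] by blast
qed

lemma is_cokernelD:
  assumes "is_cokernel C u Q j" "u \<in> Mor C A B"
  shows "j \<in> Mor C B Q" "j \<cdot> u = Zero C A Q" "surjective C j"
proof -
  show j: "j \<in> Mor C B Q" and "j \<cdot> u = Zero C A Q"
    using assms(1) MorD[OF assms(2)] by (auto simp: is_cokernel_def)
  show "surjective C j"
    using surjective_iff[OF j] cokernel_unique_factor[OF assms(1)] by blast
qed

lemma difference:
  assumes f: "f \<in> Mor C B D" and g: "g \<in> Mor C B D"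
  obtains d where "d \<in> Mor C B D"
    "\<And>X h. h \<in> Mor C X B \<Longrightarrow> d \<cdot> h = Zero C X D \<longleftrightarrow> f \<cdot> h = g \<cdot> h"
proof -
  interpret G: comm_group "Mor_group C B D"
    using Mor_comm_group Mor_Obj[OF f] by blast
  define d where "d = Add C f (inv\<^bsub>Mor_group C B D\<^esub> g)"
  have d: "d \<in> Mor C B D"
    using G.m_closed[of f "inv\<^bsub>Mor_group C B D\<^esub> g"] G.inv_closed[of g] f g
    by (simp add: Mor_group_def d_def)
  have fd: "f = Add C d g"
    using G.m_assoc[of f "inv\<^bsub>Mor_group C B D\<^esub> g" g] G.inv_closed[of g]
      G.l_inv[of g] G.r_one[of f] f g
    by (simp add: Mor_group_def d_def)
  have "d \<cdot> h = Zero C X D \<longleftrightarrow> f \<cdot> h = g \<cdot> h" if h: "h \<in> Mor C X B" for X h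
  proof -
    interpret H: comm_group "Mor_group C X D"
      using Mor_comm_group Mor_Obj[OF f] Mor_Obj[OF h] by blast
    have "d \<cdot> h \<in> Mor C X D" "g \<cdot> h \<in> Mor C X D"
      using Comp_Mor h d g by blast+
    then have "Add C (d \<cdot> h) (g \<cdot> h) = g \<cdot> h \<longleftrightarrow> d \<cdot> h = Zero C X D"
      using H.r_cancel_one[of "g \<cdot> h" "d \<cdot> h"] by (simp add: Mor_group_def)
    then show ?thesis
      using Add_Comp[OF h d g] fd by simp
  qed
  with d show thesis
    using that by blast
qed

lemma injective_kernel_zero:
  assumes "u \<in> Mor C A B" "injective C u" "is_kernel C u K k"
  shows "k = Zero C K A"
proof -
  note k = is_kernelD[OF assms(3,1)]
  have "K \<in> Obj C" "A \<in> Obj C"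
    using Mor_Obj[OF k(1)] by auto
  then show ?thesis
    using injectiveD[OF assms(2,1) k(1) Zero_Mor] k(2) Comp_Zero[OF _ assms(1)] by simp
qed

lemma isomorphism_Id: "A \<in> Obj C \<Longrightarrow> isomorphism C (Id C A)"
  using Id_Mor[of A] Id_Comp[OF Id_Mor, of A] MorD[OF Id_Mor, of A]
  by (auto simp: isomorphism_def)

text \<open>A strict injective morphism is its own image up to isomorphism, since the coimage of an
  injective morphism is its source; and an image is a kernel.\<close>

lemma strict_injective_is_kernel:
  assumes i: "i \<in> Mor C S A" and inj: "injective C i" and "strict C i"
  obtains P p where "p \<in> Mor C A P" "is_kernel C p S i"
proof -
  obtain w D e I m where "is_coimage C i D e" "is_image C i I m"
    and w: "w \<in> Mor C D I" and iw: "i = m \<cdot> w \<cdot> e" and iso: "isomorphism C w"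
    using assms(3) by (auto simp: strict_def is_induced_def)
  then obtain K k Q j where k: "is_kernel C i K k" and e: "is_cokernel C k D e"
    and j: "is_cokernel C i Q j" and m: "is_kernel C j I m"
    by (auto simp: is_coimage_def is_image_def)
  note jM = is_cokernelD[OF j i]
  note mM = is_kernelD[OF m jM(1)]
  note kM = is_kernelD[OF k i]
  note eM = is_cokernelD[OF e kM(1)]
  have S: "S \<in> Obj C" and D: "D \<in> Obj C" and I: "I \<in> Obj C"
    using Mor_Obj eM(1) w by auto
  have "Id C S \<cdot> k = Zero C K S"
    using injective_kernel_zero[OF i inj k] Id_Comp[OF kM(1)] by simp
  then obtain a where a: "a \<in> Mor C D S" "a \<cdot> e = Id C S"
    using cokernel_factor[OF e kM(1) Id_Mor[OF S]] by blast
  have ea: "e \<cdot> a = Id C D"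
    using surjectiveD[OF eM(3,1) Comp_Mor[OF a(1) eM(1)] Id_Mor[OF D]]
      Comp_assoc[OF eM(1) a(1) eM(1)] a(2) Comp_Id[OF eM(1)] Id_Comp[OF eM(1)] by simp
  obtain v where v: "v \<in> Mor C I D" "w \<cdot> v = Id C I"
    using iso MorD[OF w] by (auto simp: isomorphism_def)
  have av: "a \<cdot> v \<in> Mor C I S"
    using Comp_Mor a v by blast
  have "i \<cdot> a \<cdot> v = m \<cdot> w \<cdot> (e \<cdot> a) \<cdot> v"
    using iw Comp_assoc[OF av Comp_Mor[OF eM(1) w] mM(1)] Comp_assoc[OF av eM(1) w]
      Comp_assoc[OF v(1) a(1) eM(1)] by simp
  also have "\<dots> = m"
    using ea Id_Comp[OF v(1)] v(2) Comp_Id[OF mM(1)] by simp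
  finally have iav: "i \<cdot> a \<cdot> v = m" .
  have "is_kernel C j S i"
  proof (rule is_kernelI[OF jM(1) i jM(2) inj])
    fix X f assume "f \<in> Mor C X A" "j \<cdot> f = Zero C X Q"
    then obtain g where g: "g \<in> Mor C X I" "m \<cdot> g = f"
      using kernel_factor[OF m jM(1)] by blast
    have "i \<cdot> (a \<cdot> v) \<cdot> g = f"
      using Comp_assoc[OF g(1) av i] iav g(2) by simp
    then show "\<exists>h \<in> Mor C X S. i \<cdot> h = f"
      using Comp_Mor[OF g(1) av] by blast
  qed
  with jM(1) show thesis
    using that by blast
qed

end

section \<open>Image factorization\<close>

context semiabelian_category
begin

text \<open>A kernel is its own image, because it is the kernel of its cokernel, and its source is its
  own coimage, because it is injective. The induced morphism is then an identity.\<close>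

lemma kernel_in_strict_subobjects:
  assumes u: "u \<in> Mor C A B" and ker: "is_kernel C u K k"
  shows "(K, k) \<in> carrier (strict_subobjects C A)"
proof -
  note k = is_kernelD[OF ker u]
  have K: "K \<in> Obj C"
    using Mor_Obj[OF k(1)] by blast
  obtain Z z where z: "is_kernel C k Z z"
    using kernel_exists MorD[OF k(1)] by blast
  note zM = is_kernelD[OF z k(1)]
  have Z: "Z \<in> Obj C"
    using Mor_Obj[OF zM(1)] by blast
  have "is_cokernel C z K (Id C K)"
    using MorD[OF zM(1)] Id_Mor[OF K] injective_kernel_zero[OF k(1,3) z] Id_Comp[OF zM(1)] Comp_Id
    unfolding is_cokernel_def by metis
  with z have coim: "is_coimage C k K (Id C K)"
    by (auto simp: is_coimage_def)
  obtain Q j where j: "is_cokernel C k Q j"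
    using cokernel_exists MorD[OF k(1)] by blast
  note jM = is_cokernelD[OF j k(1)]
  obtain x where x: "x \<in> Mor C Q B" "x \<cdot> j = u"
    using cokernel_factor[OF j k(1) u k(2)] by blast
  have "is_kernel C j K k"
  proof (rule is_kernelI[OF jM(1) k(1) jM(2) k(3)])
    fix X f assume f: "f \<in> Mor C X A" "j \<cdot> f = Zero C X Q"
    then have "u \<cdot> f = Zero C X B"
      using Comp_assoc[OF f(1) jM(1) x(1)] x(2) Comp_Zero[OF _ x(1)] Mor_Obj[OF f(1)] by simp
    then show "\<exists>g \<in> Mor C X K. k \<cdot> g = f"
      using kernel_factor[OF ker u f(1)] by blast
  qed
  with j have im: "is_image C k K k"
    by (auto simp: is_image_def)
  have "k = k \<cdot> Id C K \<cdot> Id C K"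
    using Comp_Id[OF k(1)] Comp_Id[OF Id_Mor[OF K]] by simp
  then have "is_induced C k (Id C K)"
    using coim im Id_Mor[OF K] unfolding is_induced_def by blast
  then have "strict C k"
    using isomorphism_Id[OF K] by (auto simp: strict_def)
  with k show ?thesis
    by (simp add: strict_subobjects_def)
qed

text \<open>The three parts of the factorization of \<open>f\<close> through its coimage and its image, with the
  properties that make \<open>f\<close> both a cokernel followed by an injective morphism and a surjective
  morphism followed by a kernel.\<close>

lemma coimage_image_decomposition:
  assumes f: "f \<in> Mor C X A" and ker: "is_kernel C f K k" and e: "is_cokernel C k D e"
  obtains Q j I m w where "is_cokernel C f Q j" "is_kernel C j I m"
    "w \<in> Mor C D I" "bijective C w" "f = m \<cdot> w \<cdot> e"
proof -
  obtain Q j where j: "is_cokernel C f Q j"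
    using cokernel_exists MorD[OF f] by blast
  note jM = is_cokernelD[OF j f]
  obtain I m where m: "is_kernel C j I m"
    using kernel_exists MorD[OF jM(1)] by blast
  have ci: "is_coimage C f D e" "is_image C f I m"
    using ker e j m by (auto simp: is_coimage_def is_image_def)
  then obtain w where w: "w \<in> Mor C D I" "f = m \<cdot> w \<cdot> e"
    using induced_ex1 by blast
  then have "is_induced C f w"
    using ci unfolding is_induced_def by blast
  then have "bijective C w"
    using induced_bijective MorD[OF f] by blast
  then show thesis
    using that j m w by blast
qed

lemma coimage_embedding:
  assumes f: "f \<in> Mor C X A" and ker: "is_kernel C f K k" and e: "is_cokernel C k D e"
  obtains c where "c \<in> Mor C D A" "injective C c" "c \<cdot> e = f"
proof -
  obtain Q j I m w where j: "is_cokernel C f Q j" and m: "is_kernel C j I m"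
    and w: "w \<in> Mor C D I" "bijective C w" "f = m \<cdot> w \<cdot> e"
    using coimage_image_decomposition[OF assms] by blast
  note mM = is_kernelD[OF m is_cokernelD(1)[OF j f]]
  note eM = is_cokernelD[OF e is_kernelD(1)[OF ker f]]
  show thesis
  proof (rule that)
    show "m \<cdot> w \<in> Mor C D A"
      using Comp_Mor w(1) mM(1) by blast
    show "injective C (m \<cdot> w)"
      using injective_Comp[OF w(1) mM(1)] w(2) mM(3) by (simp add: bijective_def)
    show "(m \<cdot> w) \<cdot> e = f"
      using Comp_assoc[OF eM(1) w(1) mM(1)] w(3) by simp
  qed
qed

text \<open>The image \<open>(I, m)\<close> is least because a morphism vanishing on \<open>f\<close> factors through
  the cokernel of \<open>f\<close> and so vanishes on \<open>m\<close>; this applies to the morphism of which a given strict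
  subobject is the kernel.\<close>

lemma image_factorization:
  assumes f: "f \<in> Mor C X A"
  obtains I m e where "(I, m) \<in> carrier (strict_subobjects C A)" "e \<in> Mor C X I" "surjective C e"
    "m \<cdot> e = f"
    "\<forall>S i. \<forall>g \<in> Mor C X S. (S, i) \<in> carrier (strict_subobjects C A) \<longrightarrow> f = i \<cdot> g \<longrightarrow>
      subobject_le C (I, m) (S, i)"
proof -
  obtain K k where k: "is_kernel C f K k"
    using kernel_exists MorD[OF f] by blast
  note kM = is_kernelD[OF k f]
  obtain D e where e: "is_cokernel C k D e"
    using cokernel_exists MorD[OF kM(1)] by blast
  note eM = is_cokernelD[OF e kM(1)]
  obtain Q j I m w where j: "is_cokernel C f Q j" and m: "is_kernel C j I m"
    and w: "w \<in> Mor C D I" "bijective C w" "f = m \<cdot> w \<cdot> e"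
    using coimage_image_decomposition[OF f k e] by blast
  note jM = is_cokernelD[OF j f]
  note mM = is_kernelD[OF m jM(1)]
  show thesis
  proof (rule that)
    show "(I, m) \<in> carrier (strict_subobjects C A)"
      using kernel_in_strict_subobjects[OF jM(1) m] .
    show "w \<cdot> e \<in> Mor C X I"
      using Comp_Mor eM(1) w(1) by blast
    show "surjective C (w \<cdot> e)"
      using surjective_Comp[OF eM(1) w(1)] eM(3) w(2) by (simp add: bijective_def)
    show "m \<cdot> w \<cdot> e = f"
      using w(3) by simp
  next
    have "subobject_le C (I, m) (S, i)"
      if S: "(S, i) \<in> carrier (strict_subobjects C A)" and g: "g \<in> Mor C X S" and fg: "f = i \<cdot> g" for S i g
    proof -
      have i: "i \<in> Mor C S A" "injective C i" "strict C i"
        using S by (auto simp: strict_subobjects_def)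
      obtain P p where p: "p \<in> Mor C A P" "is_kernel C p S i"
        using strict_injective_is_kernel[OF i] by blast
      have P: "P \<in> Obj C"
        using Mor_Obj[OF p(1)] by blast
      have "p \<cdot> f = Zero C X P"
        using fg Comp_assoc[OF g i(1) p(1)] is_kernelD(2)[OF p(2,1)] Zero_Comp[OF P g] by simp
      then obtain x where x: "x \<in> Mor C Q P" "x \<cdot> j = p"
        using cokernel_factor[OF j f p(1)] by blast
      have "p \<cdot> m = Zero C I P"
        using x(2) Comp_assoc[OF mM(1) jM(1) x(1)] mM(2) Comp_Zero[OF _ x(1)] Mor_Obj[OF mM(1)] by simp
      then obtain l where "l \<in> Mor C I S" "i \<cdot> l = m"
        using kernel_factor[OF p(2,1) mM(1)] by blast
      then show ?thesis
        by (auto simp: subobject_le_def)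
    qed
    then show "\<forall>S i. \<forall>g \<in> Mor C X S. (S, i) \<in> carrier (strict_subobjects C A) \<longrightarrow> f = i \<cdot> g \<longrightarrow>
        subobject_le C (I, m) (S, i)"
      by blast
  qed
qed

section \<open>Infimum and supremum of strict subobjects\<close>

lemma is_glbD:
  assumes "is_glb (strict_subobjects C A) I {S, T}"
    and "S \<in> carrier (strict_subobjects C A)" "T \<in> carrier (strict_subobjects C A)"
  shows "I \<in> carrier (strict_subobjects C A)" "subobject_le C I S" "subobject_le C I T"
    and "\<And>L. \<lbrakk>L \<in> carrier (strict_subobjects C A); subobject_le C L S; subobject_le C L T\<rbrakk>
      \<Longrightarrow> subobject_le C L I"
  using assms by (auto simp: greatest_def Lower_def strict_subobjects_def)

lemma is_lubD:
  assumes "is_lub (strict_subobjects C A) U {S, T}"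
    and "S \<in> carrier (strict_subobjects C A)" "T \<in> carrier (strict_subobjects C A)"
  shows "U \<in> carrier (strict_subobjects C A)" "subobject_le C S U" "subobject_le C T U"
    and "\<And>L. \<lbrakk>L \<in> carrier (strict_subobjects C A); subobject_le C S L; subobject_le C T L\<rbrakk>
      \<Longrightarrow> subobject_le C U L"
  using assms by (auto simp: least_def Upper_def strict_subobjects_def)

text \<open>The infimum among strict subobjects is a pullback: if an arbitrary morphism factors
  through both subobjects, then its image is a strict lower bound.\<close>

lemma infimum_factor:
  assumes inf: "is_glb (strict_subobjects C A) (N, n) {(S, i), (T, j)}"
    and S: "(S, i) \<in> carrier (strict_subobjects C A)"
    and T: "(T, j) \<in> carrier (strict_subobjects C A)"
    and f: "f \<in> Mor C X S" and g: "g \<in> Mor C X T" and eq: "i \<cdot> f = j \<cdot> g"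
  shows "\<exists>h \<in> Mor C X N. n \<cdot> h = i \<cdot> f"
proof -
  note glb = is_glbD[OF inf S T]
  have i: "i \<in> Mor C S A" and n: "n \<in> Mor C N A"
    using S glb(1) by (auto simp: strict_subobjects_def)
  obtain I m e where I: "(I, m) \<in> carrier (strict_subobjects C A)" and e: "e \<in> Mor C X I"
    and "surjective C e" and me: "m \<cdot> e = i \<cdot> f"
    and least: "\<forall>S' i'. \<forall>g \<in> Mor C X S'. (S', i') \<in> carrier (strict_subobjects C A) \<longrightarrow>
      i \<cdot> f = i' \<cdot> g \<longrightarrow> subobject_le C (I, m) (S', i')"
    by (rule image_factorization[OF Comp_Mor[OF f i]])
  have "subobject_le C (I, m) (N, n)"
    using glb(4)[OF I] least S f T g eq by blast
  then obtain l where l: "l \<in> Mor C I N" "m = n \<cdot> l"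
    by (auto simp: subobject_le_def)
  have "n \<cdot> l \<cdot> e = i \<cdot> f"
    using Comp_assoc[OF e l(1) n] l(2) me by simp
  then show ?thesis
    using Comp_Mor[OF e l(1)] by blast
qed

text \<open>The equalizer \<open>N\<close> of two morphisms that agree on \<open>S\<close> and \<open>T\<close> need not be known to be strict
  in \<open>A\<close>, but its image \<open>I\<close> in \<open>A\<close> is, and \<open>I\<close> contains \<open>S\<close> and \<open>T\<close> and is contained
  in \<open>U\<close>. Hence \<open>I\<close> is all of \<open>U\<close>, and since \<open>N\<close> maps onto \<open>I\<close> the two morphisms agree.\<close>

lemma supremum_jointly_epi:
  assumes sup: "is_lub (strict_subobjects C A) (U, n) {(S, i), (T, j)}"
    and S: "(S, i) \<in> carrier (strict_subobjects C A)"
    and T: "(T, j) \<in> carrier (strict_subobjects C A)"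
    and s: "s \<in> Mor C S U" "i = n \<cdot> s" and t: "t \<in> Mor C T U" "j = n \<cdot> t"
    and f: "f \<in> Mor C U X" and g: "g \<in> Mor C U X"
    and "f \<cdot> s = g \<cdot> s" and "f \<cdot> t = g \<cdot> t"
  shows "f = g"
proof -
  note lub = is_lubD[OF sup S T]
  have n: "n \<in> Mor C U A" "injective C n"
    using lub(1) by (auto simp: strict_subobjects_def)
  have U: "U \<in> Obj C"
    using Mor_Obj[OF f] by blast
  obtain d where d: "d \<in> Mor C U X"
    and d0: "\<And>Y h. h \<in> Mor C Y U \<Longrightarrow> d \<cdot> h = Zero C Y X \<longleftrightarrow> f \<cdot> h = g \<cdot> h"
    using difference[OF f g] by blast
  obtain N k where N: "is_kernel C d N k"
    using kernel_exists MorD[OF d] by blast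
  note k = is_kernelD[OF N d]
  obtain I m e where I: "(I, m) \<in> carrier (strict_subobjects C A)"
    and e: "e \<in> Mor C N I" "surjective C e" "m \<cdot> e = n \<cdot> k"
    and least: "\<forall>S i. \<forall>g \<in> Mor C N S. (S, i) \<in> carrier (strict_subobjects C A) \<longrightarrow>
      n \<cdot> k = i \<cdot> g \<longrightarrow> subobject_le C (I, m) (S, i)"
    by (rule image_factorization[OF Comp_Mor[OF k(1) n(1)]])
  have m: "m \<in> Mor C I A"
    using I by (auto simp: strict_subobjects_def)
  have le_I: "subobject_le C (Y, n \<cdot> h) (I, m)" if h: "h \<in> Mor C Y U" "f \<cdot> h = g \<cdot> h" for Y h
  proof -
    obtain l where l: "l \<in> Mor C Y N" "k \<cdot> l = h"
      using kernel_factor[OF N d h(1)] d0[OF h(1)] h(2) by blast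
    have "n \<cdot> h = m \<cdot> e \<cdot> l"
      using l(2) Comp_assoc[OF l(1) k(1) n(1)] Comp_assoc[OF l(1) e(1) m] e(3) by simp
    then show ?thesis
      using Comp_Mor[OF l(1) e(1)] by (auto simp: subobject_le_def)
  qed
  have "subobject_le C (U, n) (I, m)"
    using lub(4)[OF I] le_I[OF s(1)] le_I[OF t(1)] s(2) t(2) assms(10,11) by simp
  then obtain l where l: "l \<in> Mor C U I" "n = m \<cdot> l"
    by (auto simp: subobject_le_def)
  have "subobject_le C (I, m) (U, n)"
    using least lub(1) k(1) by blast
  then obtain h where h: "h \<in> Mor C I U" "m = n \<cdot> h"
    by (auto simp: subobject_le_def)
  have hl: "h \<cdot> l = Id C U"
    using injectiveD[OF n(2,1) Comp_Mor[OF l(1) h(1)] Id_Mor[OF U]] Comp_assoc[OF l(1) h(1) n(1)]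
      l(2)[symmetric] h(2)[symmetric] Comp_Id[OF n(1)] by simp
  have he: "h \<cdot> e = k"
    using injectiveD[OF n(2,1) Comp_Mor[OF e(1) h(1)] k(1)] Comp_assoc[OF e(1) h(1) n(1)] e(3)
      h(2)[symmetric] by simp
  have "(f \<cdot> h) \<cdot> e = (g \<cdot> h) \<cdot> e"
    using Comp_assoc[OF e(1) h(1) f] Comp_assoc[OF e(1) h(1) g] he d0[OF k(1)] k(2) by simp
  then have "f \<cdot> h = g \<cdot> h"
    using surjectiveD[OF e(2,1) Comp_Mor[OF h(1) f] Comp_Mor[OF h(1) g]] by blast
  then have "f \<cdot> h \<cdot> l = g \<cdot> h \<cdot> l"
    unfolding Comp_assoc[OF l(1) h(1) f, symmetric] Comp_assoc[OF l(1) h(1) g, symmetric] by simp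
  then show ?thesis
    unfolding hl Comp_Id[OF f] Comp_Id[OF g] .
qed

end

section \<open>The comparison of the two quotients\<close>

theorem theorem4p11:
  fixes C :: "('o, 'm, 'e) preadditive_data_scheme"
  assumes "semiabelian_category C"
    and "A \<in> Obj C"
    and "(A', i') \<in> carrier (strict_subobjects C A)"
    and "(A'', i'') \<in> carrier (strict_subobjects C A)"
    and inf: "is_glb (strict_subobjects C A) (Acap, icap) {(A', i'), (A'', i'')}"
    and sup: "is_lub (strict_subobjects C A) (Acup, icup) {(A', i'), (A'', i'')}"
    and "u \<in> Mor C Acap A''" and "icap = i'' \<cdot>\<^bsub>C\<^esub> u"
    and "v \<in> Mor C A' Acup" and "i' = icup \<cdot>\<^bsub>C\<^esub> v"
    and "is_cokernel C u Q q"
    and "is_cokernel C v R r"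
  shows "\<exists>b \<in> Mor C Q R. bijective C b"
proof -
  interpret semiabelian_category C
    by (rule assms(1))
  note S' = assms(3) and S'' = assms(4) and u = assms(7) and icap = assms(8)
    and v = assms(9) and i'v = assms(10) and q = assms(11) and r = assms(12)
  note glb = is_glbD[OF inf S' S''] and lub = is_lubD[OF sup S' S'']
  have i': "i' \<in> Mor C A' A" "injective C i'" "strict C i'"
    and i'': "i'' \<in> Mor C A'' A" "injective C i''"
    and cap: "icap \<in> Mor C Acap A" "injective C icap"
    and cup: "icup \<in> Mor C Acup A" "injective C icup"
    using S' S'' glb(1) lub(1) by (auto simp: strict_subobjects_def)
  obtain s where s: "s \<in> Mor C Acap A'" "icap = i' \<cdot>\<^bsub>C\<^esub> s"
    using glb(2) by (auto simp: subobject_le_def)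
  obtain t where t: "t \<in> Mor C A'' Acup" "i'' = icup \<cdot>\<^bsub>C\<^esub> t"
    using lub(3) by (auto simp: subobject_le_def)
  obtain P p where p: "p \<in> Mor C A P" and kerp: "is_kernel C p A' i'"
    using strict_injective_is_kernel[OF i'] by blast
  have P: "P \<in> Obj C"
    using Mor_Obj[OF p] by blast
  note pi' = is_kernelD(2)[OF kerp p]
  note qM = is_cokernelD[OF q u] and rM = is_cokernelD[OF r v]
  have R: "R \<in> Obj C"
    using Mor_Obj[OF rM(1)] by blast
  have pi'': "p \<cdot>\<^bsub>C\<^esub> i'' \<in> Mor C A'' P" and pcup: "p \<cdot>\<^bsub>C\<^esub> icup \<in> Mor C Acup P"
    using Comp_Mor i''(1) cup(1) p by blast+

  \<comment> \<open>What \<open>p i''\<close> kills lies in \<open>A'\<close> and in \<open>A''\<close>, hence factors through the infimum.\<close>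
  have keru: "is_kernel C (p \<cdot>\<^bsub>C\<^esub> i'') Acap u"
  proof (rule is_kernelI[OF pi'' u])
    show "(p \<cdot>\<^bsub>C\<^esub> i'') \<cdot>\<^bsub>C\<^esub> u = Zero C Acap P"
      using Comp_assoc[OF u i''(1) p] icap s(2) Comp_assoc[OF s(1) i'(1) p] pi'
        Zero_Comp[OF P s(1)] by simp
    show "injective C u"
      using injective_right_factor[OF u i''(1)] cap(2) icap by simp
  next
    fix X f assume f: "f \<in> Mor C X A''" and "(p \<cdot>\<^bsub>C\<^esub> i'') \<cdot>\<^bsub>C\<^esub> f = Zero C X P"
    then have "p \<cdot>\<^bsub>C\<^esub> i'' \<cdot>\<^bsub>C\<^esub> f = Zero C X P"
      using Comp_assoc[OF f i''(1) p] by simp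
    then obtain g where g: "g \<in> Mor C X A'" "i' \<cdot>\<^bsub>C\<^esub> g = i'' \<cdot>\<^bsub>C\<^esub> f"
      using kernel_factor[OF kerp p Comp_Mor[OF f i''(1)]] by blast
    obtain h where h: "h \<in> Mor C X Acap" "icap \<cdot>\<^bsub>C\<^esub> h = i'' \<cdot>\<^bsub>C\<^esub> f"
      using infimum_factor[OF inf S' S'' g(1) f g(2)] g(2) by auto
    have "u \<cdot>\<^bsub>C\<^esub> h = f"
      using injectiveD[OF i''(2,1) Comp_Mor[OF h(1) u] f] Comp_assoc[OF h(1) u i''(1)] h(2) icap
      by simp
    then show "\<exists>g \<in> Mor C X Acap. u \<cdot>\<^bsub>C\<^esub> g = f"
      using h(1) by blast
  qed

  have kerv: "is_kernel C (p \<cdot>\<^bsub>C\<^esub> icup) A' v"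
  proof (rule is_kernelI[OF pcup v])
    show "(p \<cdot>\<^bsub>C\<^esub> icup) \<cdot>\<^bsub>C\<^esub> v = Zero C A' P"
      using Comp_assoc[OF v cup(1) p] i'v pi' by simp
    show "injective C v"
      using injective_right_factor[OF v cup(1)] i'(2) i'v by simp
  next
    fix X f assume f: "f \<in> Mor C X Acup" and "(p \<cdot>\<^bsub>C\<^esub> icup) \<cdot>\<^bsub>C\<^esub> f = Zero C X P"
    then have "p \<cdot>\<^bsub>C\<^esub> icup \<cdot>\<^bsub>C\<^esub> f = Zero C X P"
      using Comp_assoc[OF f cup(1) p] by simp
    then obtain g where g: "g \<in> Mor C X A'" "i' \<cdot>\<^bsub>C\<^esub> g = icup \<cdot>\<^bsub>C\<^esub> f"
      using kernel_factor[OF kerp p Comp_Mor[OF f cup(1)]] by blast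
    have "v \<cdot>\<^bsub>C\<^esub> g = f"
      using injectiveD[OF cup(2,1) Comp_Mor[OF g(1) v] f] Comp_assoc[OF g(1) v cup(1)] g(2) i'v
      by simp
    then show "\<exists>g \<in> Mor C X A'. v \<cdot>\<^bsub>C\<^esub> g = f"
      using g(1) by blast
  qed

  obtain c where c: "c \<in> Mor C Q P" "injective C c" "c \<cdot>\<^bsub>C\<^esub> q = p \<cdot>\<^bsub>C\<^esub> i''"
    using coimage_embedding[OF pi'' keru q] by blast
  obtain d where d: "d \<in> Mor C R P" "injective C d" "d \<cdot>\<^bsub>C\<^esub> r = p \<cdot>\<^bsub>C\<^esub> icup"
    using coimage_embedding[OF pcup kerv r] by blast

  have "icup \<cdot>\<^bsub>C\<^esub> t \<cdot>\<^bsub>C\<^esub> u = icup \<cdot>\<^bsub>C\<^esub> v \<cdot>\<^bsub>C\<^esub> s"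
    using Comp_assoc[OF u t(1) cup(1)] Comp_assoc[OF s(1) v cup(1)] t(2) i'v icap s(2) by simp
  then have tu: "t \<cdot>\<^bsub>C\<^esub> u = v \<cdot>\<^bsub>C\<^esub> s"
    using injectiveD[OF cup(2,1) Comp_Mor[OF u t(1)] Comp_Mor[OF s(1) v]] by blast
  have rt: "r \<cdot>\<^bsub>C\<^esub> t \<in> Mor C A'' R"
    using Comp_Mor t(1) rM(1) by blast
  have "(r \<cdot>\<^bsub>C\<^esub> t) \<cdot>\<^bsub>C\<^esub> u = Zero C Acap R"
    using Comp_assoc[OF u t(1) rM(1)] tu Comp_assoc[OF s(1) v rM(1)] rM(2) Zero_Comp[OF R s(1)]
    by simp
  then obtain b where b: "b \<in> Mor C Q R" "b \<cdot>\<^bsub>C\<^esub> q = r \<cdot>\<^bsub>C\<^esub> t"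
    using cokernel_factor[OF q u rt] by blast

  \<comment> \<open>\<open>b\<close> commutes with the embeddings \<open>c\<close> and \<open>d\<close> of the two quotients in \<open>A/A'\<close>.\<close>
  have "(d \<cdot>\<^bsub>C\<^esub> b) \<cdot>\<^bsub>C\<^esub> q = c \<cdot>\<^bsub>C\<^esub> q"
    using Comp_assoc[OF qM(1) b(1) d(1)] b(2) Comp_assoc[OF t(1) rM(1) d(1)] d(3) c(3)
      Comp_assoc[OF t(1) cup(1) p] t(2) by simp
  then have "d \<cdot>\<^bsub>C\<^esub> b = c"
    using surjectiveD[OF qM(3,1) Comp_Mor[OF b(1) d(1)] c(1)] by blast
  then have inj: "injective C b"
    using injective_right_factor[OF b(1) d(1)] c(2) by simp

  have "f = g" if f: "f \<in> Mor C R X" and g: "g \<in> Mor C R X" and fg: "f \<cdot>\<^bsub>C\<^esub> b = g \<cdot>\<^bsub>C\<^esub> b" for X f g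
  proof -
    have "(f \<cdot>\<^bsub>C\<^esub> r) \<cdot>\<^bsub>C\<^esub> v = (g \<cdot>\<^bsub>C\<^esub> r) \<cdot>\<^bsub>C\<^esub> v"
      using Comp_assoc[OF v rM(1) f] Comp_assoc[OF v rM(1) g] rM(2) Comp_Zero[OF _ f]
        Comp_Zero[OF _ g] Mor_Obj[OF v] by simp
    moreover have "(f \<cdot>\<^bsub>C\<^esub> r) \<cdot>\<^bsub>C\<^esub> t = (g \<cdot>\<^bsub>C\<^esub> r) \<cdot>\<^bsub>C\<^esub> t"
      using Comp_assoc[OF t(1) rM(1) f] Comp_assoc[OF t(1) rM(1) g] Comp_assoc[OF qM(1) b(1) f]
        Comp_assoc[OF qM(1) b(1) g] b(2) fg by simp
    ultimately have "f \<cdot>\<^bsub>C\<^esub> r = g \<cdot>\<^bsub>C\<^esub> r"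
      using supremum_jointly_epi[OF sup S' S'' v i'v t Comp_Mor[OF rM(1) f] Comp_Mor[OF rM(1) g]]
      by blast
    then show "f = g"
      using surjectiveD[OF rM(3,1) f g] by blast
  qed
  then have "surjective C b"
    using surjective_iff[OF b(1)] by blast
  with inj b(1) show ?thesis
    by (auto simp: bijective_def)
qed

end
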